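(* Let $(X,\|\cdot\|)$ be a real normed space equipped with a compatible regular pairing $\llbracket\cdot,\cdot\rrbracket$, and let $T$ be a (possibly set-valued) operator on $X$. Then $T$ is monotone if and only if $\angle_L(x,y)\le\pi/2$ for all $(x,y)\in\mathrm{i}\!\operatorname{gra}(T)$ with $x\neq0$ and $y\neq 0$.
   Context: Weak and regular pairings. A weak pairing on a real normed space $(X,\|\cdot\|)$ is a map $\llbracket\cdot,\cdot\rrbracket:X\times X\to\mathbb{R}$ that satisfies: subadditivity in the first argument, $\llbracket x_1+x_2,y\rrbracket\le\llbracket x_1,y\rrbracket+\llbracket x_2,y\rrbracket$; weak homogeneity, $\llbracket \alpha x,y\rrbracket=\llbracket x,\alpha y\rrbracket=\alpha\llbracket x,y\rrbracket$ for $\alpha\ge 0$ and $\llbracket -x,-y\rrbracket=\llbracket x,y\rrbracket$; positive definiteness, $\llbracket x,x\rrbracket>0$ for $x\ne 0$; and the Cauchy–Schwarz inequality, $|\llbracket x,y\rrbracket|\le\llbracket x,x\rrbracket^{1/2}\llbracket y,y\rrbracket^{1/2}$. It is compatible with the norm if $\llbracket x,x\rrbracket=\|x\|^2$ for all $x$. A compatible weak pairing is regular if it satisfies the straight angle property $\llbracket -x,x\rrbracket=-\|x\|^2$ for all $x\in X$; equivalently, partial linearity $\llbracket x+ay,y\rrbracket=\llbracket x,y\rrbracket+a\|y\|^2$ for all $x,y\in X$, $a\in\mathbb{R}$. Left angle. For nonzero $x,y\in X$, $\cos_L(x,y)=\dfrac{\llbracket y,x\rrbracket}{\|x\|\|y\|}\in[-1,1]$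 and $\angle_L(x,y)=\arccos(\cos_L(x,y))\in[0,\pi]$. Operators. An operator $T$ on $X$ is a possibly set-valued map, identified with its graph $\operatorname{gra}(T)=\{(x,y): y\in T(x)\}\subseteq X\times X$, and $\mathrm{i}\!\operatorname{gra}(T)=\{(x_1-x_2,y_1-y_2):(x_1,y_1),(x_2,y_2)\in\operatorname{gra}(T)\}$. $T$ is monotone if $\llbracket y,x\rrbracket\ge0$ for all $(x,y)\in\mathrm{i}\!\operatorname{gra}(T)$. *)

theory Defs
  imports Complex_Main
begin

locale weak_pairing =
  fixes pairing :: "'a::real_normed_vector \<Rightarrow> 'a \<Rightarrow> real"
  assumes subadditive: "pairing (x1 + x2) y \<le> pairing x1 y + pairing x2 y"
    and scale_left: "0 \<le> \<alpha> \<Longrightarrow> pairing (\<alpha> *\<^sub>R x) y = \<alpha> * pairing x y"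
    and scale_right: "0 \<le> \<alpha> \<Longrightarrow> pairing x (\<alpha> *\<^sub>R y) = \<alpha> * pairing x y"
    and minus_minus: "pairing (- x) (- y) = pairing x y"
    and positive_definite: "x \<noteq> 0 \<Longrightarrow> 0 < pairing x x"
    and Cauchy_Schwarz: "\<bar>pairing x y\<bar> \<le> sqrt (pairing x x) * sqrt (pairing y y)"

locale compatible_weak_pairing = weak_pairing +
  assumes compatible: "pairing x x = (norm x)\<^sup>2"

locale regular_pairing = compatible_weak_pairing +
  assumes straight_angle: "pairing (- x) x = - (norm x)\<^sup>2"

text \<open>The left cosine and the left angle are meaningful for nonzero arguments only. Note that
  the order of the arguments is swapped in the pairing.\<close>

definition cos_L :: "('a::real_normed_vector \<Rightarrow> 'a \<Rightarrow> real) \<Rightarrow> 'a \<Rightarrow> 'a \<Rightarrow> real" where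
  "cos_L pairing x y = pairing y x / (norm x * norm y)"

definition angle_L :: "('a::real_normed_vector \<Rightarrow> 'a \<Rightarrow> real) \<Rightarrow> 'a \<Rightarrow> 'a \<Rightarrow> real" where
  "angle_L pairing x y = arccos (cos_L pairing x y)"

lemma (in compatible_weak_pairing) cos_L_bounds:
  assumes "x \<noteq> 0" "y \<noteq> 0"
  shows "cos_L pairing x y \<in> {-1..1}"
proof -
  have "\<bar>pairing y x\<bar> \<le> norm x * norm y"
    using Cauchy_Schwarz[of y x] by (simp add: compatible mult.commute)
  moreover have "0 < norm x * norm y"
    using assms by simp
  ultimately show ?thesis
    by (auto simp: cos_L_def field_simps abs_le_iff)
qed

definition gra :: "('a \<Rightarrow> 'a set) \<Rightarrow> ('a \<times> 'a) set" where
  "gra T = {(x, y). y \<in> T x}"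

definition igra :: "('a::real_normed_vector \<Rightarrow> 'a set) \<Rightarrow> ('a \<times> 'a) set" where
  "igra T = {(x1 - x2, y1 - y2) | x1 x2 y1 y2. (x1, y1) \<in> gra T \<and> (x2, y2) \<in> gra T}"

definition monotone_op ::
  "('a::real_normed_vector \<Rightarrow> 'a \<Rightarrow> real) \<Rightarrow> ('a \<Rightarrow> 'a set) \<Rightarrow> bool" where
  "monotone_op pairing T \<longleftrightarrow> (\<forall>(x, y) \<in> igra T. 0 \<le> pairing y x)"

end

theory Submission
  imports Defs
begin

text \<open>The equivalence holds pair by pair, whatever the operator. For nonzero x and y the
  cosine has the sign of \<open>pairing y x\<close>, since it is divided by a positive number, and
  arccos decreases through pi / 2 at 0 (\<open>angle_L_le_pi_half_iff\<close>). If x or y is zero,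
  weak homogeneity with factor 0 makes the pairing vanish.\<close>

lemma arccos_le_pi_half_iff:
  assumes "x \<in> {-1..1}"
  shows "arccos x \<le> pi / 2 \<longleftrightarrow> 0 \<le> x"
  using arccos_le_mono[of x 0] assms by (simp add: abs_le_iff)

lemma (in weak_pairing) pairing_zero_left [simp]: "pairing 0 y = 0"
  using scale_left[of 0 0 y] by simp

lemma (in weak_pairing) pairing_zero_right [simp]: "pairing x 0 = 0"
  using scale_right[of 0 x 0] by simp

text \<open>Cauchy-Schwarz enters through \<open>cos_L_bounds\<close>: it keeps the quotient in
  [-1, 1], where arccos is strictly decreasing.\<close>

lemma (in compatible_weak_pairing) angle_L_le_pi_half_iff:
  assumes "x \<noteq> 0" "y \<noteq> 0"
  shows "angle_L pairing x y \<le> pi / 2 \<longleftrightarrow> 0 \<le> pairing y x"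
proof -
  have "angle_L pairing x y \<le> pi / 2 \<longleftrightarrow> 0 \<le> cos_L pairing x y"
    unfolding angle_L_def by (rule arccos_le_pi_half_iff[OF cos_L_bounds[OF assms]])
  also have "\<dots> \<longleftrightarrow> 0 \<le> pairing y x"
    using assms by (simp add: cos_L_def zero_le_divide_iff mult_le_0_iff)
  finally show ?thesis .
qed

theorem lemma2:
  fixes pairing :: "'a::real_normed_vector \<Rightarrow> 'a \<Rightarrow> real"
    and T :: "'a \<Rightarrow> 'a set"
  assumes "regular_pairing pairing"
  shows "monotone_op pairing T \<longleftrightarrow>
    (\<forall>(x, y) \<in> igra T. x \<noteq> 0 \<and> y \<noteq> 0 \<longrightarrow> angle_L pairing x y \<le> pi / 2)"
proof -
  interpret regular_pairing pairing
    by (fact assms)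
  have "0 \<le> pairing y x \<longleftrightarrow> (x \<noteq> 0 \<and> y \<noteq> 0 \<longrightarrow> angle_L pairing x y \<le> pi / 2)" for x y
    \<comment> \<open>In the degenerate case both sides are true: the pairing is 0 and the
      implication is vacuous.\<close>
    by (cases "x = 0 \<or> y = 0") (use angle_L_le_pi_half_iff[of x y] in auto)
  then show ?thesis
    by (simp add: monotone_op_def)
qed

end
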